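(* Let a labelled triangle shape be chosen at random according to the uniform distribution (normalized area measure) on the shape sphere $\mathbb{S}^2$ of labelled planar triangles. Then, with tallness and flatness taken with respect to a given cluster labelling choice, $$\mathrm{Prob}(\text{Flat}) = \frac12 = \mathrm{Prob}(\text{Tall}).$$
   Context: A labelled triangle is an ordered triple $(q_1,q_2,q_3)$ of points of $\mathbb{R}^2$, not all three equal. Its shape is its equivalence class under translations, rotations and positive dilations (vertices are labelled; mirror images are not identified). Relative Jacobi coordinates: $R_1 = q_3 - q_2$ and $R_2 = q_1 - \tfrac12(q_2+q_3)$. Mass-weighted relative Jacobi coordinates: $\vec\rho_1 = \sqrt{1/2}\,R_1$ and $\vec\rho_2 = \sqrt{2/3}\,R_2$, with magnitudes $\rho_1,\rho_2$. The shape sphere is the unit sphere $\mathbb{S}^2\subset\mathbb{R}^3$ with its standard round metric. Shapes are identified with its points by the bijection sending the shape of $(q_1,q_2,q_3)$ to $$(X,Y,Z) = \frac{\left(2\,\vec\rho_1\cdot\vec\rho_2,\; 2(\vec\rho_1\times\vec\rho_2)_3,\; \rho_1^2-\rho_2^2\right)}{\rho_1^2+\rho_2^2},$$ where $(\vec a\times\vec b)_3 = a_1b_2-a_2b_1$. The uniform distribution is surface area measure divided by $4\pi$. A cluster labelling is a choice of apex vertex; the base is the opposite side and the median is the segment from the midpoint of the base to the apex. For apex $q_1$, the partial moments of inertia of the base and of the median are $\rho_1^2$ and $\rho_2^2$ respectively; for the other apexes they are defined by the same formulas after permuting vertices cyclically. With respect to a given cluster labelling, a triangle is tall if the partial moment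 of inertia of its median exceeds that of its base, and flat if the partial moment of inertia of its base exceeds that of its median. $\mathrm{Prob}(P)$ denotes the probability of the set of shapes having property $P$. *)

theory Defs
  imports "HOL-Analysis.Analysis"
begin

section \<open>Labelled triangles and their shapes\<close>

text \<open>The vertices are indexed by the type \<open>3\<close>, in which arithmetic is modulo 3, so that
  \<open>3 = 0\<close> and \<open>i + 1\<close> is the cyclic successor of \<open>i\<close>.\<close>

type_synonym triple = "(real ^ 2) ^ 3"

definition labelled_triangles :: "triple set" where
  "labelled_triangles = {q. \<not> (q $ 1 = q $ 2 \<and> q $ 2 = q $ 3)}"

definition same_shape :: "(triple \<times> triple) set" where
  "same_shape = {(q, q'). q \<in> labelled_triangles \<and> q' \<in> labelled_triangles \<and>
     (\<exists>A t c. rotation_matrix A \<and> c > 0 \<and> (\<forall>i. q' $ i = c *\<^sub>R (A *v (q $ i)) + t))}"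

definition shapes :: "triple set set" where
  "shapes = labelled_triangles // same_shape"

section \<open>Jacobi coordinates and the shape sphere\<close>

definition jacobi_1 :: "triple \<Rightarrow> real ^ 2" where
  "jacobi_1 q = q $ 3 - q $ 2"

definition jacobi_2 :: "triple \<Rightarrow> real ^ 2" where
  "jacobi_2 q = q $ 1 - (1 / 2) *\<^sub>R (q $ 2 + q $ 3)"

definition rho_1 :: "triple \<Rightarrow> real ^ 2" where
  "rho_1 q = sqrt (1 / 2) *\<^sub>R jacobi_1 q"

definition rho_2 :: "triple \<Rightarrow> real ^ 2" where
  "rho_2 q = sqrt (2 / 3) *\<^sub>R jacobi_2 q"

definition planar_cross :: "real ^ 2 \<Rightarrow> real ^ 2 \<Rightarrow> real" where
  "planar_cross a b = a $ 1 * b $ 2 - a $ 2 * b $ 1"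

definition shape_coords :: "triple \<Rightarrow> real ^ 3" where
  "shape_coords q = (1 / ((norm (rho_1 q))\<^sup>2 + (norm (rho_2 q))\<^sup>2)) *\<^sub>R
     vector [2 * (rho_1 q \<bullet> rho_2 q),
             2 * planar_cross (rho_1 q) (rho_2 q),
             (norm (rho_1 q))\<^sup>2 - (norm (rho_2 q))\<^sup>2]"

text \<open>\<open>shape_coords\<close> is constant on each shape; \<open>shape_point\<close> is the induced map, which
  identifies \<open>shapes\<close> with \<open>sphere 0 1\<close>.\<close>

definition shape_point :: "triple set \<Rightarrow> real ^ 3" where
  "shape_point S = the_elem (shape_coords ` S)"

section \<open>Surface area on the unit sphere\<close>

definition sphere_param :: "real \<times> real \<Rightarrow> real ^ 3" where
  "sphere_param = (\<lambda>(\<theta>, \<phi>). vector [sin \<phi> * cos \<theta>, sin \<phi> * sin \<theta>, cos \<phi>])"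

text \<open>The area element of the round metric in the coordinates \<open>(\<theta>, \<phi>)\<close> is the norm of the
  cross product of the two coordinate tangent vectors.\<close>

definition area_element :: "real \<times> real \<Rightarrow> real" where
  "area_element = (\<lambda>(\<theta>, \<phi>). norm (cross3
     (vector_derivative (\<lambda>s. sphere_param (s, \<phi>)) (at \<theta>))
     (vector_derivative (\<lambda>s. sphere_param (\<theta>, s)) (at \<phi>))))"

text \<open>On the parameter domain below \<open>sphere_param\<close> is onto the sphere and, off the two poles,
  injective.\<close>

definition sphere_area :: "(real ^ 3) measure" where
  "sphere_area =
     distr (density (restrict_space lborel ({0..<2 * pi} \<times> {0..pi}))
                    (\<lambda>p. ennreal (area_element p)))
       (restrict_space borel (sphere 0 1)) sphere_param"

definition uniform_sphere :: "(real ^ 3) measure" where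
  "uniform_sphere = scale_measure (ennreal (1 / (4 * pi))) sphere_area"

text \<open>The argument is a property of triangles that is invariant under \<open>same_shape\<close>.\<close>

definition Prob :: "(triple \<Rightarrow> bool) \<Rightarrow> real" where
  "Prob P = measure uniform_sphere (shape_point ` {S \<in> shapes. \<forall>q \<in> S. P q})"

section \<open>Tall and flat triangles\<close>

text \<open>A cluster labelling is given by the index \<open>a\<close> of the apex; \<open>relabel a\<close> permutes the
  vertices cyclically so that the apex becomes vertex 1.\<close>

definition relabel :: "3 \<Rightarrow> triple \<Rightarrow> triple" where
  "relabel a q = (\<chi> i. q $ (a + (i - 1)))"

definition base_moment :: "3 \<Rightarrow> triple \<Rightarrow> real" where
  "base_moment a q = (norm (rho_1 (relabel a q)))\<^sup>2"

definition median_moment :: "3 \<Rightarrow> triple \<Rightarrow> real" where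
  "median_moment a q = (norm (rho_2 (relabel a q)))\<^sup>2"

definition tall :: "3 \<Rightarrow> triple \<Rightarrow> bool" where
  "tall a q \<longleftrightarrow> median_moment a q > base_moment a q"

definition flat :: "3 \<Rightarrow> triple \<Rightarrow> bool" where
  "flat a q \<longleftrightarrow> base_moment a q > median_moment a q"

end

theory Submission
  imports Defs
begin

text \<open>
  For a fixed apex, the difference between the partial moments of inertia of base and median,
  divided by the total moment of inertia, is a linear functional \<open>p \<mapsto> u \<bullet> p\<close> of the point \<open>p\<close> of the
  shape sphere, with \<open>u \<noteq> 0\<close>. For apex 1 it is the coordinate \<open>Z\<close> itself. Changing the apex
  cyclically rotates the pair of mass-weighted Jacobi vectors by a third of a turn
  (\<open>relabel_rotates\<close>), which rotates the shape sphere about its \<open>Y\<close>-axis and so gives again a linear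
  functional (\<open>base_minus_median_moment\<close>). Since the shape coordinates are invariant under similarity
  and map onto the sphere, the flat shapes fill exactly the open hemisphere \<open>0 < u \<bullet> p\<close> and the tall
  ones the opposite hemisphere.

  Every open hemisphere has probability one half (\<open>measure_open_hemisphere\<close>): the antipodal map
  preserves area and exchanges it with the opposite hemisphere, the great circle between them is
  null, and the whole sphere has area \<open>4 * pi\<close>.
\<close>

section \<open>Area on the sphere in polar coordinates\<close>

lemma sphere_param_eq_axis:
  "sphere_param p = (sin (snd p) * cos (fst p)) *\<^sub>R axis 1 1
     + (sin (snd p) * sin (fst p)) *\<^sub>R axis 2 1 + cos (snd p) *\<^sub>R axis 3 1"
  by (simp add: sphere_param_def case_prod_beta vec_eq_iff forall_3 axis_def)

lemma norm_sphere_param: "norm (sphere_param p) = 1"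
proof -
  have "(norm (sphere_param p))\<^sup>2 =
      (sin (snd p))\<^sup>2 * ((cos (fst p))\<^sup>2 + (sin (fst p))\<^sup>2) + (cos (snd p))\<^sup>2"
    unfolding power2_norm_eq_inner distrib_left
    by (simp add: inner_vec_def sum_3 sphere_param_def case_prod_beta power2_eq_square mult_ac
      del: sin_cos_squared_add sin_cos_squared_add2 sin_cos_squared_add3)
  then have "(norm (sphere_param p))\<^sup>2 = 1\<^sup>2" by simp
  then show ?thesis by (simp only: power2_eq_iff_nonneg norm_ge_zero zero_le_one)
qed

text \<open>The two tangent vectors are orthogonal, of lengths \<open>\<bar>sin \<phi>\<bar>\<close> and \<open>1\<close>; their cross product is a
  multiple of the radial vector.\<close>

lemma area_element_eq: "area_element p = \<bar>sin (snd p)\<bar>"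
proof -
  obtain \<theta> \<phi> where p: "p = (\<theta>, \<phi>)" by (cases p)
  let ?u = "(- sin \<phi> * sin \<theta>) *\<^sub>R axis 1 1 + (sin \<phi> * cos \<theta>) *\<^sub>R axis 2 1 :: real^3"
  let ?v = "(cos \<phi> * cos \<theta>) *\<^sub>R axis 1 1 + (cos \<phi> * sin \<theta>) *\<^sub>R axis 2 1 + (- sin \<phi>) *\<^sub>R axis 3 1 :: real^3"
  have 1: "((\<lambda>s. sphere_param (s, \<phi>)) has_vector_derivative ?u) (at \<theta>)"
    unfolding sphere_param_eq_axis fst_conv snd_conv
    by (auto intro!: derivative_eq_intros has_vector_derivative_scaleR simp: mult.commute)
  have 2: "((\<lambda>s. sphere_param (\<theta>, s)) has_vector_derivative ?v) (at \<phi>)"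
    unfolding sphere_param_eq_axis fst_conv snd_conv
    by (auto intro!: derivative_eq_intros has_vector_derivative_scaleR simp: mult.commute)
  have "area_element p = norm (cross3 ?u ?v)"
    using 1 2 by (simp add: p area_element_def vector_derivative_at)
  also have "cross3 ?u ?v = (- sin \<phi>) *\<^sub>R sphere_param p"
  proof -
    have "- (sin \<phi> * sin \<theta> * (cos \<phi> * sin \<theta>)) - sin \<phi> * cos \<theta> * (cos \<phi> * cos \<theta>) = - (sin \<phi> * cos \<phi>)"
      using sin_cos_squared_add3[of \<theta>] by algebra
    then show ?thesis
      by (simp add: p sphere_param_def vec_eq_iff forall_3 axis_def cross3_def)
  qed
  finally show ?thesis by (simp add: norm_sphere_param p)
qed

lemma sphere_param_antipode: "sphere_param (\<theta> + pi, pi - \<phi>) = - sphere_param (\<theta>, \<phi>)"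
  by (simp add: sphere_param_def vec_eq_iff forall_3)

lemma continuous_sphere_param: "continuous_on A sphere_param"
  unfolding sphere_param_eq_axis[abs_def] by (intro continuous_intros)

lemma measurable_sphere_param[measurable]: "sphere_param \<in> borel_measurable borel"
  by (intro borel_measurable_continuous_onI continuous_sphere_param)

lemma measurable_abs_sin_snd[measurable]:
  "(\<lambda>p::real \<times> real. \<bar>sin (snd p)\<bar>) \<in> borel_measurable borel"
  by (intro borel_measurable_continuous_onI continuous_intros)

lemma emeasure_sphere_area:
  assumes "A \<in> sets borel" "A \<subseteq> sphere 0 1"
  shows "emeasure sphere_area A = (\<integral>\<^sup>+p. ennreal \<bar>sin (snd p)\<bar> *
    indicator ({0..<2 * pi} \<times> {0..pi}) p * indicator A (sphere_param p) \<partial>lborel)"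
proof -
  define D where "D = {0..<2 * pi} \<times> {0..pi}"
  have D[measurable]: "D \<in> sets borel"
    unfolding D_def by (auto simp: borel_prod[symmetric])
  have [measurable]: "A \<in> sets borel" by fact
  let ?M = "restrict_space lborel D"
  have m: "sphere_param \<in> density ?M (\<lambda>p. ennreal (area_element p)) \<rightarrow>\<^sub>M restrict_space borel (sphere 0 1)"
    by (intro measurable_restrict_space2)
       (auto simp: norm_sphere_param cong: measurable_cong_sets intro!: measurable_restrict_space1)
  have "emeasure sphere_area A =
      emeasure (density ?M (\<lambda>p. ennreal (area_element p))) (sphere_param -` A \<inter> D)"
    unfolding sphere_area_def D_def[symmetric] using assms
    by (subst emeasure_distr[OF m]) (auto simp: sets_restrict_space_iff space_restrict_space)
  also have "\<dots> = (\<integral>\<^sup>+p. ennreal \<bar>sin (snd p)\<bar> * indicator (sphere_param -` A \<inter> D) p \<partial>?M)"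
    unfolding area_element_eq
    by (subst emeasure_density) (auto simp: sets_restrict_space_iff intro!: measurable_restrict_space1)
  also have "\<dots> = (\<integral>\<^sup>+p. ennreal \<bar>sin (snd p)\<bar> * indicator (sphere_param -` A \<inter> D) p * indicator D p \<partial>lborel)"
    by (subst nn_integral_restrict_space) auto
  also have "\<dots> = (\<integral>\<^sup>+p. ennreal \<bar>sin (snd p)\<bar> * indicator D p * indicator A (sphere_param p) \<partial>lborel)"
    by (intro nn_integral_cong) (auto simp: indicator_def)
  finally show ?thesis unfolding D_def .
qed

lemma sphere_area_total:
  "(\<integral>\<^sup>+p. ennreal \<bar>sin (snd p)\<bar> * indicator ({0..<2 * pi} \<times> {0..pi}) p \<partial>lborel) = ennreal (4 * pi)"
proof -
  have "(\<integral>\<^sup>+y. ennreal \<bar>sin y\<bar> * indicator {0..pi} y \<partial>lborel) =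
      (\<integral>\<^sup>+y. ennreal (sin y) * indicator {0..pi} y \<partial>lborel)"
    by (intro nn_integral_cong) (auto simp: indicator_def sin_ge_zero)
  also have "\<dots> = ennreal (- cos pi - - cos 0)"
    by (intro nn_integral_FTC_Icc) (auto intro!: derivative_eq_intros sin_ge_zero)
  finally have inner: "(\<integral>\<^sup>+y. ennreal \<bar>sin y\<bar> * indicator {0..pi} y \<partial>lborel) = 2" by simp
  have "(\<integral>\<^sup>+p. ennreal \<bar>sin (snd p)\<bar> * indicator ({0..<2 * pi} \<times> {0..pi}) p \<partial>lborel) =
     (\<integral>\<^sup>+x. \<integral>\<^sup>+y. (ennreal \<bar>sin y\<bar> * indicator {0..pi} y) * indicator {0..<2 * pi} x \<partial>lborel \<partial>lborel)"
    by (subst lborel_prod[symmetric], subst lborel.nn_integral_fst[symmetric])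
       (auto simp: indicator_times mult_ac)
  also have "\<dots> = (\<integral>\<^sup>+x. 2 * indicator {0..<2 * pi} x \<partial>lborel)"
    by (simp add: nn_integral_multc inner)
  also have "\<dots> = ennreal (4 * pi)"
    by (simp add: nn_integral_cmult_indicator ennreal_numeral[symmetric] ennreal_mult[symmetric] del: ennreal_numeral)
  finally show ?thesis .
qed

section \<open>Hemispheres\<close>

text \<open>If \<open>x0\<close> is one zero and \<open>x\<close> another, then the nonzero vector \<open>(A, B)\<close> is orthogonal to both
  \<open>(cos x0, sin x0)\<close> and \<open>(cos x, sin x)\<close>. These are therefore parallel, so that
  \<open>sin (x - x0) = 0\<close>.\<close>

lemma countable_zeros_sinusoid:
  fixes A B :: real
  assumes "(A, B) \<noteq> (0, 0)"
  shows "countable {x. A * cos x + B * sin x = 0}"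
proof (cases "\<exists>x0. A * cos x0 + B * sin x0 = 0")
  case True
  then obtain x0 where x0: "A * cos x0 + B * sin x0 = 0" by blast
  have "{x. A * cos x + B * sin x = 0} \<subseteq> range (\<lambda>k::int. x0 + of_int k * pi)"
  proof
    fix x assume "x \<in> {x. A * cos x + B * sin x = 0}"
    then have x: "A * cos x + B * sin x = 0" by simp
    have "A * sin (x - x0) = 0" "B * sin (x - x0) = 0"
      unfolding sin_diff using x x0 by algebra+
    then have "sin (x - x0) = 0" using assms by auto
    then obtain k :: int where "x - x0 = of_int k * pi" using sin_zero_iff_int2 by blast
    then have "x = x0 + of_int k * pi" by simp
    then show "x \<in> range (\<lambda>k::int. x0 + of_int k * pi)" by blast
  qed
  then show ?thesis by (rule countable_subset) simp
qed auto

text \<open>By Fubini. On the meridian of longitude \<open>\<theta>\<close>, the function \<open>u \<bullet> sphere_param (\<theta>, \<phi>)\<close> is a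
  sinusoid in \<open>\<phi>\<close> with coefficients \<open>u $ 3\<close> and \<open>u $ 1 * cos \<theta> + u $ 2 * sin \<theta>\<close>, hence nonzero
  outside a countable set unless both coefficients vanish. If \<open>u $ 3 = 0\<close>, the second coefficient
  is itself a nontrivial sinusoid in \<open>\<theta>\<close>, so this exception occurs for only countably many \<open>\<theta>\<close>.\<close>

lemma AE_not_on_great_circle:
  assumes "u \<noteq> 0"
  shows "AE p in lborel. u \<bullet> sphere_param p \<noteq> 0"
proof -
  let ?A = "\<lambda>\<theta>. u $ 1 * cos \<theta> + u $ 2 * sin \<theta>"
  have inner: "u \<bullet> sphere_param (\<theta>, \<phi>) = u $ 3 * cos \<phi> + ?A \<theta> * sin \<phi>" for \<theta> \<phi>
    by (simp add: inner_vec_def sum_3 sphere_param_def algebra_simps)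
  have zeros: "AE x in lborel. a * cos x + b * sin x \<noteq> 0" if "(a, b) \<noteq> (0, 0)" for a b :: real
    using countable_imp_null_set_lborel[OF countable_zeros_sinusoid[OF that]]
    by (auto dest!: AE_not_in)
  have "AE \<theta> in lborel. (u $ 3, ?A \<theta>) \<noteq> (0, 0)"
  proof (cases "u $ 3 = 0")
    case True
    then have "(u $ 1, u $ 2) \<noteq> (0, 0)" using assms by (auto simp: vec_eq_iff forall_3)
    from zeros[OF this] show ?thesis by simp
  qed simp
  then have "AE \<theta> in lborel. AE \<phi> in lborel. u \<bullet> sphere_param (\<theta>, \<phi>) \<noteq> 0"
    unfolding inner by eventually_elim (rule zeros)
  moreover have "{p. u \<bullet> sphere_param p \<noteq> 0} \<in> sets borel" by measurable
  then have "{p \<in> space (lborel \<Otimes>\<^sub>M lborel). u \<bullet> sphere_param p \<noteq> 0} \<in> sets (lborel \<Otimes>\<^sub>M lborel)"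
    unfolding lborel_prod by simp
  ultimately have "AE p in lborel \<Otimes>\<^sub>M lborel. u \<bullet> sphere_param p \<noteq> 0"
    by (intro lborel_pair.AE_pair_measure) simp_all
  then show ?thesis unfolding lborel_prod .
qed

text \<open>With \<open>a = b = pi\<close> the substitution is the antipodal map in polar coordinates.\<close>

lemma nn_integral_shift_reflect:
  fixes h :: "real \<times> real \<Rightarrow> ennreal"
  assumes "h \<in> borel_measurable borel"
  shows "(\<integral>\<^sup>+p. h p \<partial>lborel) = (\<integral>\<^sup>+p. h (fst p + a, b - snd p) \<partial>lborel)"
proof -
  have [measurable]: "h \<in> borel_measurable (borel \<Otimes>\<^sub>M borel)"
    using assms by (simp add: borel_prod)
  have "(\<integral>\<^sup>+p. h p \<partial>lborel) = (\<integral>\<^sup>+x. \<integral>\<^sup>+y. h (x, y) \<partial>lborel \<partial>lborel)"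
    by (simp add: lborel_prod[symmetric] lborel.nn_integral_fst[symmetric])
  also have "\<dots> = (\<integral>\<^sup>+x. \<integral>\<^sup>+y. h (x, b - y) \<partial>lborel \<partial>lborel)"
    by (subst nn_integral_real_affine[where t = b and c = "-1"]) auto
  also have "\<dots> = (\<integral>\<^sup>+x. \<integral>\<^sup>+y. h (x + a, b - y) \<partial>lborel \<partial>lborel)"
    by (subst nn_integral_real_affine[where t = a and c = 1]) (auto simp: add.commute)
  also have "\<dots> = (\<integral>\<^sup>+p. h (fst p + a, b - snd p) \<partial>lborel)"
    by (subst lborel_prod[symmetric]) (subst lborel.nn_integral_fst[symmetric], auto)
  finally show ?thesis .
qed

text \<open>The antipodal map carries an open hemisphere to the opposite one. In the parameters it is
  \<open>(\<theta>, \<phi>) \<mapsto> (\<theta> + pi, pi - \<phi>)\<close>, with \<open>\<theta>\<close> taken modulo \<open>2 * pi\<close>; it preserves Lebesgue measure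
  and \<open>\<bar>sin \<phi>\<bar>\<close>, so the two hemispheres have the same area. They cover the sphere up to a great
  circle, which is null, so each has half of the total area.\<close>

lemma measure_open_hemisphere:
  fixes u :: "real ^ 3"
  assumes "u \<noteq> 0"
  shows "measure uniform_sphere {p \<in> sphere 0 1. 0 < u \<bullet> p} = 1 / 2"
proof -
  define D where "D = {0..<2 * pi} \<times> {0..pi}"
  \<comment> \<open>Cutting the longitudes at \<open>pi\<close> turns the shift modulo \<open>2 * pi\<close> into a plain translation of one
      half-open strip onto the other.\<close>
  define D1 where "D1 = {0..<pi} \<times> {0..pi}"
  define D2 where "D2 = {pi..<2 * pi} \<times> {0..pi}"
  have [measurable]: "D \<in> sets borel" "D1 \<in> sets borel" "D2 \<in> sets borel"
    unfolding D_def D1_def D2_def by (auto simp: borel_prod[symmetric])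
  define h where "h u E p = ennreal \<bar>sin (snd p)\<bar> * indicator E p * indicator {0<..} (u \<bullet> sphere_param p)"
    for u E p
  have h[measurable]: "h u E \<in> borel_measurable borel" if [measurable]: "E \<in> sets borel" for u E
    unfolding h_def by measurable
  have "h u D p = h u D1 p + h u D2 p" for u p
    by (auto simp: h_def D_def D1_def D2_def indicator_def)
  then have D: "(\<integral>\<^sup>+p. h u D p \<partial>lborel) = (\<integral>\<^sup>+p. h u D1 p \<partial>lborel) + (\<integral>\<^sup>+p. h u D2 p \<partial>lborel)" for u
    by (simp add: nn_integral_add)
  have "h u D2 (fst p + pi, pi - snd p) = h (- u) D1 p" for u p
    by (cases p) (auto simp: h_def D1_def D2_def indicator_def sphere_param_antipode)
  then have antipodal: "(\<integral>\<^sup>+p. h u D2 p \<partial>lborel) = (\<integral>\<^sup>+p. h (- u) D1 p \<partial>lborel)" for u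
    by (subst nn_integral_shift_reflect[where a = pi and b = pi]) simp_all
  have "(\<integral>\<^sup>+p. h u D p \<partial>lborel) = (\<integral>\<^sup>+p. h (- u) D p \<partial>lborel)"
    using antipodal[of u] antipodal[of "- u"] by (simp add: D add.commute)
  then have "2 * (\<integral>\<^sup>+p. h u D p \<partial>lborel) = (\<integral>\<^sup>+p. h u D p \<partial>lborel) + (\<integral>\<^sup>+p. h (- u) D p \<partial>lborel)"
    by (simp add: mult_2)
  also have "\<dots> = (\<integral>\<^sup>+p. h u D p + h (- u) D p \<partial>lborel)"
    by (subst nn_integral_add) auto
  also have "\<dots> = (\<integral>\<^sup>+p. ennreal \<bar>sin (snd p)\<bar> * indicator D p \<partial>lborel)"
    by (rule nn_integral_cong_AE, use AE_not_on_great_circle[OF assms] in eventually_elim)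
       (auto simp: h_def indicator_def)
  also have "\<dots> = ennreal (4 * pi)"
    unfolding D_def by (rule sphere_area_total)
  finally have I: "2 * (\<integral>\<^sup>+p. h u D p \<partial>lborel) = ennreal (4 * pi)" .
  have "emeasure sphere_area {p \<in> sphere 0 1. 0 < u \<bullet> p} = (\<integral>\<^sup>+p. h u D p \<partial>lborel)"
    unfolding D_def h_def
    by (subst emeasure_sphere_area) (auto simp: indicator_def norm_sphere_param intro!: nn_integral_cong)
  then have "2 * emeasure sphere_area {p \<in> sphere 0 1. 0 < u \<bullet> p} = ennreal (4 * pi)" using I by simp
  then have e: "emeasure sphere_area {p \<in> sphere 0 1. 0 < u \<bullet> p} = ennreal (2 * pi)"
    by (cases "emeasure sphere_area {p \<in> sphere 0 1. 0 < u \<bullet> p}")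
      (auto simp: ennreal_numeral[symmetric] ennreal_mult[symmetric] ennreal_top_mult ennreal_mult_top simp del: ennreal_numeral)
  have "ennreal (1 / (4 * pi)) * ennreal (2 * pi) = ennreal (1 / 2)"
    by (subst ennreal_mult[symmetric]) simp_all
  then show ?thesis
    unfolding measure_def uniform_sphere_def emeasure_scale_measure e
    by (simp only:) (rule enn2real_ennreal, simp)
qed

section \<open>Shapes as points of the sphere\<close>

lemma planar_cross_scaleR: "planar_cross (c *\<^sub>R x) (c *\<^sub>R y) = c\<^sup>2 * planar_cross x y"
  by (simp add: planar_cross_def power2_eq_square algebra_simps)

lemma same_shape_refl:
  assumes "q \<in> labelled_triangles" shows "(q, q) \<in> same_shape"
proof -
  have "rotation_matrix (mat 1 :: real ^ 2 ^ 2) \<and> (1 :: real) > 0 \<and>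
      (\<forall>i. q $ i = 1 *\<^sub>R (mat 1 *v (q $ i)) + 0)"
    by (simp add: rotation_matrix_def orthogonal_matrix_id)
  then show ?thesis
    unfolding same_shape_def using assms by blast
qed

text \<open>Translations cancel in the Jacobi vectors; a rotation preserves their inner products and their
  cross product; a dilation by \<open>c\<close> multiplies numerator and denominator by \<open>c\<^sup>2\<close>.\<close>

lemma shape_coords_same_shape:
  assumes "(q, q') \<in> same_shape" shows "shape_coords q' = shape_coords q"
proof -
  obtain A t c where A: "rotation_matrix A" "c > 0" "\<And>i. q' $ i = c *\<^sub>R (A *v (q $ i)) + t"
    using assms by (auto simp: same_shape_def)
  have orth: "orthogonal_matrix A" "det A = 1" using A(1) by (auto simp: rotation_matrix_def)
  have rho: "rho_1 q' = c *\<^sub>R (A *v rho_1 q)" "rho_2 q' = c *\<^sub>R (A *v rho_2 q)"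
     by (simp_all add: rho_1_def rho_2_def jacobi_1_def jacobi_2_def A(3) vec_eq_iff forall_2 matrix_vector_mult_def sum_2
       algebra_simps)
  have "orthogonal_transformation (\<lambda>x. A *v x)"
    using orth(1) by (simp add: orthogonal_transformation_matrix)
  then have inn: "(A *v x) \<bullet> (A *v y) = x \<bullet> y" for x y
    by (simp add: orthogonal_transformation_def)
  have "planar_cross (A *v x) (A *v y) = det A * planar_cross x y" for x y
    by (simp add: planar_cross_def det_2 matrix_vector_mult_def sum_2 algebra_simps)
  then have cr: "planar_cross (c *\<^sub>R (A *v x)) (c *\<^sub>R (A *v y)) = c\<^sup>2 * planar_cross x y" for x y
    using orth(2) by (simp add: planar_cross_scaleR)
  have nrm: "(norm (c *\<^sub>R (A *v x)))\<^sup>2 = c\<^sup>2 * (norm x)\<^sup>2" for x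
    unfolding power2_norm_eq_inner by (simp add: inn power2_eq_square)
  have "(vector [2 * (rho_1 q' \<bullet> rho_2 q'), 2 * planar_cross (rho_1 q') (rho_2 q'),
        (norm (rho_1 q'))\<^sup>2 - (norm (rho_2 q'))\<^sup>2] :: real ^ 3) =
      c\<^sup>2 *\<^sub>R vector [2 * (rho_1 q \<bullet> rho_2 q), 2 * planar_cross (rho_1 q) (rho_2 q),
        (norm (rho_1 q))\<^sup>2 - (norm (rho_2 q))\<^sup>2]"
    unfolding rho nrm cr
    by (simp add: vec_eq_iff forall_3 inn power2_eq_square algebra_simps)
  moreover have "(norm (rho_1 q'))\<^sup>2 + (norm (rho_2 q'))\<^sup>2 =
      c\<^sup>2 * ((norm (rho_1 q))\<^sup>2 + (norm (rho_2 q))\<^sup>2)"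
    unfolding rho nrm by (simp add: distrib_left)
  ultimately show ?thesis
    using \<open>c > 0\<close> by (simp add: shape_coords_def)
qed

lemma moment_of_inertia_pos:
  assumes "q \<in> labelled_triangles" shows "0 < (norm (rho_1 q))\<^sup>2 + (norm (rho_2 q))\<^sup>2"
proof (rule ccontr)
  assume "\<not> ?thesis"
  then have "rho_1 q = 0 \<and> rho_2 q = 0"
    by (simp add: sum_power2_gt_zero_iff)
  then have "q $ 3 = q $ 2" "q $ 1 = (1 / 2) *\<^sub>R (q $ 2 + q $ 3)"
    by (auto simp: rho_1_def rho_2_def jacobi_1_def jacobi_2_def)
  then have "q $ 1 = q $ 2 \<and> q $ 2 = q $ 3"
    by (simp flip: scaleR_2)
  then show False using assms by (simp add: labelled_triangles_def)
qed

text \<open>Lagrange's identity: \<open>(x \<bullet> y)\<^sup>2\<close> plus the square of the cross product is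
  \<open>\<bar>x\<bar>\<^sup>2 * \<bar>y\<bar>\<^sup>2\<close>.\<close>

lemma norm_shape_coords:
  assumes "q \<in> labelled_triangles" shows "norm (shape_coords q) = 1"
proof -
  let ?x = "rho_1 q" and ?y = "rho_2 q"
  define I where "I = (norm ?x)\<^sup>2 + (norm ?y)\<^sup>2"
  define v :: "real ^ 3"
    where "v = vector [2 * (?x \<bullet> ?y), 2 * planar_cross ?x ?y, (norm ?x)\<^sup>2 - (norm ?y)\<^sup>2]"
  have I: "0 < I" unfolding I_def by (rule moment_of_inertia_pos[OF assms])
  have "(norm v)\<^sup>2 = I\<^sup>2"
    unfolding v_def I_def power2_norm_eq_inner
    by (simp add: inner_vec_def sum_3 sum_2 planar_cross_def) algebra
  then have "norm v = I"
    using I by simp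
  moreover have "shape_coords q = (1 / I) *\<^sub>R v"
    by (simp add: shape_coords_def v_def I_def)
  ultimately show ?thesis using I by simp
qed

lemma rho_surj:
  obtains q where "rho_1 q = x" "rho_2 q = y"
proof
  define q :: triple where
    "q = vector [sqrt (3 / 2) *\<^sub>R y, - (sqrt 2 / 2) *\<^sub>R x, (sqrt 2 / 2) *\<^sub>R x]"
  have s: "sqrt (1 / 2) * sqrt 2 = 1" "sqrt (2 / 3) * sqrt (3 / 2) = 1"
    by (simp_all flip: real_sqrt_mult)
  have "jacobi_1 q = sqrt 2 *\<^sub>R x"
    by (simp add: q_def jacobi_1_def flip: scaleR_add_left)
  then show "rho_1 q = x"
    by (simp only: rho_1_def scaleR_scaleR s) simp
  have "jacobi_2 q = sqrt (3 / 2) *\<^sub>R y"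
    by (simp add: q_def jacobi_2_def)
  then show "rho_2 q = y"
    by (simp only: rho_2_def scaleR_scaleR s) simp
qed

text \<open>The map \<open>(rho_1, rho_2) \<mapsto> (X, Y, Z)\<close> is the Hopf map, for which \<open>((1 + Z, 0), (X, Y))\<close> is an
  explicit preimage. It vanishes at the single point \<open>Z = -1\<close>, where the base is degenerate and
  \<open>(0, (1, 0))\<close> serves instead.\<close>

lemma shape_coords_surj:
  assumes "p \<in> sphere 0 1"
  obtains q where "q \<in> labelled_triangles" "shape_coords q = p"
proof -
  have sq: "(p $ 1)\<^sup>2 + (p $ 2)\<^sup>2 + (p $ 3)\<^sup>2 = 1"
    using assms by (simp add: norm_eq_1 inner_vec_def sum_3 power2_eq_square)
  define x y :: "real ^ 2"
    where "x = (if p $ 3 = - 1 then 0 else vector [1 + p $ 3, 0])"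
      and "y = (if p $ 3 = - 1 then vector [1, 0] else vector [p $ 1, p $ 2])"
  obtain q where q: "rho_1 q = x" "rho_2 q = y" using rho_surj by blast
  have "q \<in> labelled_triangles"
  proof (rule ccontr)
    assume "q \<notin> labelled_triangles"
    then have "q $ 3 = q $ 2" "q $ 1 = q $ 2" by (auto simp: labelled_triangles_def)
    then have "x = 0" "y = 0"
      unfolding q[symmetric]
      by (simp_all add: rho_1_def rho_2_def jacobi_1_def jacobi_2_def flip: scaleR_2)
    then show False by (auto simp: x_def y_def vec_eq_iff forall_2 split: if_splits)
  qed
  moreover have "shape_coords q = p"
  proof (cases "p $ 3 = - 1")
    case True
    then have "p $ 1 = 0" "p $ 2 = 0" using sq by (simp_all add: add_nonneg_eq_0_iff)
    with True show ?thesis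
      by (simp add: shape_coords_def q x_def y_def vec_eq_iff forall_3 planar_cross_def
          power2_norm_eq_inner inner_vec_def sum_2)
  next
    case False
    define d where "d = 2 * (1 + p $ 3)"
    have d: "d \<noteq> 0" using False by (simp add: d_def add_eq_0_iff)
    have "(norm x)\<^sup>2 = (1 + p $ 3)\<^sup>2" "(norm y)\<^sup>2 = (p $ 1)\<^sup>2 + (p $ 2)\<^sup>2"
      "2 * (x \<bullet> y) = d * p $ 1" "2 * planar_cross x y = d * p $ 2"
      using False unfolding power2_norm_eq_inner
      by (simp_all add: x_def y_def d_def inner_vec_def sum_2 planar_cross_def power2_eq_square)
    moreover have "(1 + p $ 3)\<^sup>2 + ((p $ 1)\<^sup>2 + (p $ 2)\<^sup>2) = d"
       "(1 + p $ 3)\<^sup>2 - ((p $ 1)\<^sup>2 + (p $ 2)\<^sup>2) = d * p $ 3"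
      using sq unfolding d_def by algebra+
    ultimately show ?thesis
      using d by (simp add: shape_coords_def q vec_eq_iff forall_3)
  qed
  ultimately show thesis by (rule that)
qed

text \<open>Reduces a probability over equivalence classes of triangles to the area of a subset of the
  sphere, for properties that can be read off the shape coordinates.\<close>

lemma Prob_eq_measure_uniform_sphere:
  assumes "\<And>q. q \<in> labelled_triangles \<Longrightarrow> P q \<longleftrightarrow> Q (shape_coords q)"
  shows "Prob P = measure uniform_sphere {p \<in> sphere 0 1. Q p}"
proof -
  have cls: "shape_coords ` (same_shape `` {q}) = {shape_coords q}" if "q \<in> labelled_triangles" for q
    using same_shape_refl[OF that] shape_coords_same_shape by blast
  have dom: "same_shape `` {q} \<subseteq> labelled_triangles" for q by (auto simp: same_shape_def)
  have "shape_point ` {S \<in> shapes. \<forall>q \<in> S. P q} = {p \<in> sphere 0 1. Q p}"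
  proof (intro equalityI subsetI)
    fix p assume "p \<in> shape_point ` {S \<in> shapes. \<forall>q \<in> S. P q}"
    then obtain q where q: "q \<in> labelled_triangles" "\<forall>q' \<in> same_shape `` {q}. P q'" "p = shape_point (same_shape `` {q})"
      by (auto simp: shapes_def quotient_def)
    then show "p \<in> {p \<in> sphere 0 1. Q p}"
      using same_shape_refl[OF q(1)] assms[OF q(1)] norm_shape_coords[OF q(1)]
      by (auto simp: shape_point_def cls)
  next
    fix p assume p: "p \<in> {p \<in> sphere 0 1. Q p}"
    then obtain q where q: "q \<in> labelled_triangles" "shape_coords q = p"
      using shape_coords_surj by blast
    let ?S = "same_shape `` {q}"
    have "P q'" if "q' \<in> ?S" for q'
      using that dom p q assms shape_coords_same_shape by fastforce
    moreover have "?S \<in> shapes" using q by (auto simp: shapes_def quotient_def)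
    moreover have "p = shape_point ?S" using q by (simp add: shape_point_def cls)
    ultimately show "p \<in> shape_point ` {S \<in> shapes. \<forall>q \<in> S. P q}" by blast
  qed
  then show ?thesis by (simp add: Prob_def)
qed

section \<open>Flat and tall shapes form opposite hemispheres\<close>

lemma relabel_nth:
  "relabel 1 q $ 1 = q $ 1" "relabel 1 q $ 2 = q $ 2" "relabel 1 q $ 3 = q $ 3"
  "relabel 2 q $ 1 = q $ 2" "relabel 2 q $ 2 = q $ 3" "relabel 2 q $ 3 = q $ 1"
  "relabel 3 q $ 1 = q $ 3" "relabel 3 q $ 2 = q $ 1" "relabel 3 q $ 3 = q $ 2"
proof -
  have *: "(4 :: 3) = 1" "(5 :: 3) = 2" by simp_all
  show "relabel 1 q $ 1 = q $ 1" "relabel 1 q $ 2 = q $ 2" "relabel 1 q $ 3 = q $ 3"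
    "relabel 2 q $ 1 = q $ 2" "relabel 2 q $ 2 = q $ 3" "relabel 2 q $ 3 = q $ 1"
    "relabel 3 q $ 1 = q $ 3" "relabel 3 q $ 2 = q $ 1" "relabel 3 q $ 3 = q $ 2"
    by (simp_all add: relabel_def *)
qed

text \<open>A cyclic relabelling rotates the pair of mass-weighted vectors \<open>(rho_1, rho_2)\<close> by a third of a
  turn, mixing the two vectors but not their components. The mass weights are exactly what makes
  this change of Jacobi coordinates orthogonal.\<close>

lemma relabel_rotates:
  "rho_1 (relabel 2 q) = (sqrt 3 / 2) *\<^sub>R rho_2 q - (1 / 2) *\<^sub>R rho_1 q"
  "rho_2 (relabel 2 q) = - (sqrt 3 / 2) *\<^sub>R rho_1 q - (1 / 2) *\<^sub>R rho_2 q"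
  "rho_1 (relabel 3 q) = - (sqrt 3 / 2) *\<^sub>R rho_2 q - (1 / 2) *\<^sub>R rho_1 q"
  "rho_2 (relabel 3 q) = (sqrt 3 / 2) *\<^sub>R rho_1 q - (1 / 2) *\<^sub>R rho_2 q"
proof -
  have s: "sqrt (1 / 2) = sqrt 2 / 2" "sqrt (2 / 3) = sqrt 2 * sqrt 3 / 3"
    by (simp_all add: real_sqrt_divide field_simps)
  have sqrt3: "sqrt 3 * (sqrt 3 * x) = 3 * x" for x :: real by (simp flip: mult.assoc)
  show "rho_1 (relabel 2 q) = (sqrt 3 / 2) *\<^sub>R rho_2 q - (1 / 2) *\<^sub>R rho_1 q"
    "rho_2 (relabel 2 q) = - (sqrt 3 / 2) *\<^sub>R rho_1 q - (1 / 2) *\<^sub>R rho_2 q"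
    "rho_1 (relabel 3 q) = - (sqrt 3 / 2) *\<^sub>R rho_2 q - (1 / 2) *\<^sub>R rho_1 q"
    "rho_2 (relabel 3 q) = (sqrt 3 / 2) *\<^sub>R rho_1 q - (1 / 2) *\<^sub>R rho_2 q"
    unfolding rho_1_def rho_2_def jacobi_1_def jacobi_2_def relabel_nth s vec_eq_iff
    by (auto simp: field_simps sqrt3)
qed

text \<open>The centre of the hemisphere of flat shapes. For apex 1 it is the pole \<open>Z = 1\<close>, where the
  apex lies at the midpoint of the base. The other two apexes give its images under the rotations
  about the \<open>Y\<close>-axis by a third of a turn in either direction.\<close>

definition flat_pole :: "3 \<Rightarrow> real ^ 3" where
  "flat_pole a = (if a = 1 then vector [0, 0, 1]
     else if a = 2 then vector [- sqrt 3 / 2, 0, - 1 / 2]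
     else vector [sqrt 3 / 2, 0, - 1 / 2])"

text \<open>The quantities \<open>2 rho_1 \<bullet> rho_2\<close> and \<open>\<bar>rho_1\<bar>\<^sup>2 - \<bar>rho_2\<bar>\<^sup>2\<close> are the two components of a vector that
  turns by \<open>2 \<alpha>\<close> when \<open>(rho_1, rho_2)\<close> turns by \<open>\<alpha>\<close>. So the difference of the partial moments for
  any apex is a linear functional of the unnormalized shape coordinates.\<close>

lemma base_minus_median_moment:
  "base_moment a q - median_moment a q = flat_pole a \<bullet> vector [2 * (rho_1 q \<bullet> rho_2 q),
             2 * planar_cross (rho_1 q) (rho_2 q),
             (norm (rho_1 q))\<^sup>2 - (norm (rho_2 q))\<^sup>2]"
proof -
  have sqrt3: "sqrt 3 * (sqrt 3 * x) = 3 * x" for x :: real by (simp flip: mult.assoc)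
  have [simp]: "relabel 1 q = q" by (simp add: vec_eq_iff forall_3 relabel_nth)
  consider "a = 1" | "a = 2" | "a = 3" using exhaust_3[of a] by blast
  then show ?thesis
    by cases (simp_all add: base_moment_def median_moment_def flat_pole_def relabel_rotates
        inner_vec_def[where 'b = 3] sum_3 power2_norm_eq_inner inner_diff_left inner_diff_right inner_commute
        sqrt3 field_simps)
qed

lemma flat_iff_hemisphere:
  assumes "q \<in> labelled_triangles" shows "flat a q \<longleftrightarrow> 0 < flat_pole a \<bullet> shape_coords q"
   and tall_iff_hemisphere: "tall a q \<longleftrightarrow> 0 < - flat_pole a \<bullet> shape_coords q"
proof -
  let ?I = "(norm (rho_1 q))\<^sup>2 + (norm (rho_2 q))\<^sup>2"
  have "flat_pole a \<bullet> shape_coords q = (base_moment a q - median_moment a q) / ?I"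
    by (simp add: base_minus_median_moment shape_coords_def)
  with moment_of_inertia_pos[OF assms] show "flat a q \<longleftrightarrow> 0 < flat_pole a \<bullet> shape_coords q"
    "tall a q \<longleftrightarrow> 0 < - flat_pole a \<bullet> shape_coords q"
    by (simp_all add: flat_def tall_def zero_less_divide_iff divide_less_0_iff)
qed

theorem mainTheorem4:
  fixes a :: 3
  shows "Prob (flat a) = 1 / 2 \<and> Prob (tall a) = 1 / 2"
proof
  have nz: "flat_pole a \<noteq> 0" by (auto simp: flat_pole_def vec_eq_iff forall_3)
  have "Prob (flat a) = measure uniform_sphere {p \<in> sphere 0 1. 0 < flat_pole a \<bullet> p}"
    by (rule Prob_eq_measure_uniform_sphere) (rule flat_iff_hemisphere)
  then show "Prob (flat a) = 1 / 2"
    by (simp only: measure_open_hemisphere[OF nz])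
  have "Prob (tall a) = measure uniform_sphere {p \<in> sphere 0 1. 0 < - flat_pole a \<bullet> p}"
    by (rule Prob_eq_measure_uniform_sphere) (rule tall_iff_hemisphere)
  then show "Prob (tall a) = 1 / 2"
    using nz by (simp only: measure_open_hemisphere neg_equal_0_iff_equal not_False_eq_True)
qed

end
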